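(* Let $\Omega\subset\mathbb{R}^\nu$ be a bounded Lipschitz domain, $k>0$, and $f\in L^2(\Omega)$ complex-valued. Consider the energy $\mathcal{E}_P:H^1(\Omega;\mathbb{C})\to\mathbb{R}$, $$\mathcal{E}_P(v)=\int_\Omega\frac12\big(|\nabla v|^2-k^2|v|^2\big)\,dx-\Re\int_\Omega f\,\overline v\,dx .$$ The stationary points of $\mathcal{E}_P$ on $H^1(\Omega;\mathbb{C})$, i.e. the $u\in H^1(\Omega;\mathbb{C})$ with $\langle D\mathcal{E}_P(u),v\rangle=0$ for all $v\in H^1(\Omega;\mathbb{C})$, satisfy the Helmholtz equation $-\Delta u-k^2u=f$ in $\Omega$ in the sense of distributions.
   Context: The derivative is the real one: $\langle D\mathcal{E}_P(u),v\rangle=\frac{d}{dt}\mathcal{E}_P(u+tv)|_{t=0}$ with $t\in\mathbb{R}$, for $u,v\in H^1(\Omega;\mathbb{C})$ (i.e. $H^1(\Omega;\mathbb{C})$ is regarded as a real vector space). *)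

theory Defs
  imports "HOL-Analysis.Analysis"
begin

text \<open>
  Near each boundary point \<open>\<Omega>\<close> is the part of a ball above a Lipschitz graph. Here \<open>e\<close> is the
  unit vector of the local vertical axis, \<open>y \<bullet> e\<close> the height of \<open>y\<close>, and
  \<open>y - (y \<bullet> e) *\<^sub>R e\<close> its projection to the hyperplane orthogonal to \<open>e\<close>, on which the graph
  function \<open>\<gamma>\<close> lives.
\<close>

definition bounded_lipschitz_domain :: "(real^'n) set \<Rightarrow> bool" where
  "bounded_lipschitz_domain \<Omega> \<longleftrightarrow>
     open \<Omega> \<and> connected \<Omega> \<and> \<Omega> \<noteq> {} \<and> bounded \<Omega> \<and>
     (\<forall>x\<in>frontier \<Omega>. \<exists>r>0. \<exists>e L \<gamma>. norm e = 1 \<and> L-lipschitz_on {z. z \<bullet> e = 0} (\<gamma> :: real^'n \<Rightarrow> real) \<and>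
        \<Omega> \<inter> ball x r = {y \<in> ball x r. y \<bullet> e > \<gamma> (y - (y \<bullet> e) *\<^sub>R e)})"

definition partial_deriv :: "'n \<Rightarrow> (real^'n \<Rightarrow> complex) \<Rightarrow> real^'n \<Rightarrow> complex" where
  "partial_deriv j \<phi> x = frechet_derivative \<phi> (at x) (axis j 1)"

primrec C_k :: "nat \<Rightarrow> (real^'n \<Rightarrow> complex) \<Rightarrow> bool" where
  "C_k 0 \<phi> \<longleftrightarrow> continuous_on UNIV \<phi>"
| "C_k (Suc m) \<phi> \<longleftrightarrow> \<phi> differentiable_on UNIV \<and> (\<forall>j. C_k m (partial_deriv j \<phi>))"

text \<open>The space of test functions \<open>C\<^sub>c\<^sup>\<infinity>(\<Omega>; \<complex>)\<close>; its elements are extended by zero outside \<open>\<Omega>\<close>.\<close>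

definition test_functions :: "(real^'n) set \<Rightarrow> (real^'n \<Rightarrow> complex) set" where
  "test_functions \<Omega> =
     {\<phi>. (\<forall>m. C_k m \<phi>) \<and> compact (closure {x. \<phi> x \<noteq> 0}) \<and> closure {x. \<phi> x \<noteq> 0} \<subseteq> \<Omega>}"

text \<open>
  Distributions are functionals on test functions; two distributions on \<open>\<Omega>\<close> are equal if
  they agree on \<open>test_functions \<Omega>\<close>. The pairing is bilinear, without complex conjugation.
\<close>

definition regular_distr ::
  "(real^'n) set \<Rightarrow> (real^'n \<Rightarrow> complex) \<Rightarrow> (real^'n \<Rightarrow> complex) \<Rightarrow> complex" where
  "regular_distr \<Omega> u \<phi> = (LINT x|lebesgue_on \<Omega>. u x * \<phi> x)"

definition distr_partial ::
  "'n \<Rightarrow> ((real^'n \<Rightarrow> complex) \<Rightarrow> complex) \<Rightarrow> (real^'n \<Rightarrow> complex) \<Rightarrow> complex" where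
  "distr_partial j T \<phi> = - T (partial_deriv j \<phi>)"

definition distr_laplacian ::
  "((real^'n \<Rightarrow> complex) \<Rightarrow> complex) \<Rightarrow> (real^'n \<Rightarrow> complex) \<Rightarrow> complex" where
  "distr_laplacian T \<phi> = (\<Sum>j\<in>UNIV. distr_partial j (distr_partial j T) \<phi>)"

text \<open>
  Elements of \<open>L\<^sup>2(\<Omega>; \<complex>)\<close> and \<open>H\<^sup>1(\<Omega>; \<complex>)\<close> are represented by functions, not by classes modulo
  almost-everywhere equality; values outside \<open>\<Omega>\<close> are irrelevant.
\<close>

definition L2 :: "(real^'n) set \<Rightarrow> (real^'n \<Rightarrow> complex) set" where
  "L2 \<Omega> = {u \<in> borel_measurable (lebesgue_on \<Omega>). integrable (lebesgue_on \<Omega>) (\<lambda>x. (cmod (u x))\<^sup>2)}"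

definition is_weak_gradient ::
  "(real^'n) set \<Rightarrow> (real^'n \<Rightarrow> complex) \<Rightarrow> (real^'n \<Rightarrow> complex^'n) \<Rightarrow> bool" where
  "is_weak_gradient \<Omega> u g \<longleftrightarrow>
     (\<forall>j. (\<lambda>x. g x $ j) \<in> L2 \<Omega> \<and>
          (\<forall>\<phi>\<in>test_functions \<Omega>.
             regular_distr \<Omega> (\<lambda>x. g x $ j) \<phi> = distr_partial j (regular_distr \<Omega> u) \<phi>))"

definition H1 :: "(real^'n) set \<Rightarrow> (real^'n \<Rightarrow> complex) set" where
  "H1 \<Omega> = {u \<in> L2 \<Omega>. \<exists>g. is_weak_gradient \<Omega> u g}"

text \<open>
  The weak gradient is unique only up to null sets, so this picks a representative; integrals
  over \<open>\<Omega>\<close> do not depend on the choice.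
\<close>

definition weak_gradient :: "(real^'n) set \<Rightarrow> (real^'n \<Rightarrow> complex) \<Rightarrow> real^'n \<Rightarrow> complex^'n" where
  "weak_gradient \<Omega> u = (SOME g. is_weak_gradient \<Omega> u g)"

definition energy ::
  "(real^'n) set \<Rightarrow> real \<Rightarrow> (real^'n \<Rightarrow> complex) \<Rightarrow> (real^'n \<Rightarrow> complex) \<Rightarrow> real" where
  "energy \<Omega> k f v =
     (LINT x|lebesgue_on \<Omega>. 1/2 * ((norm (weak_gradient \<Omega> v x))\<^sup>2 - k\<^sup>2 * (cmod (v x))\<^sup>2))
     - Re (LINT x|lebesgue_on \<Omega>. f x * cnj (v x))"

definition stationary_point ::
  "(real^'n) set \<Rightarrow> real \<Rightarrow> (real^'n \<Rightarrow> complex) \<Rightarrow> (real^'n \<Rightarrow> complex) \<Rightarrow> bool" where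
  "stationary_point \<Omega> k f u \<longleftrightarrow>
     u \<in> H1 \<Omega> \<and>
     (\<forall>v\<in>H1 \<Omega>. ((\<lambda>t::real. energy \<Omega> k f (\<lambda>x. u x + t *\<^sub>R v x)) has_real_derivative 0) (at 0))"

end

theory Submission
  imports Defs
begin

text \<open>
  Along a line \<open>u + t v\<close> the energy is a quadratic polynomial in \<open>t\<close>, whose linear coefficient is
  the weak form of the Helmholtz equation tested with \<open>v\<close>. For this, the gradient chosen for
  \<open>u + t v\<close> must agree almost everywhere with the combination of gradients of \<open>u\<close> and \<open>v\<close>, which
  is the fundamental lemma of the calculus of variations. Taking \<open>v = cnj \<phi>\<close> for a test function
  \<open>\<phi>\<close> yields the real part of the distributional equation, and replacing \<open>\<phi>\<close> by \<open>\<i> \<phi>\<close> yields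
  the imaginary part.
\<close>

section \<open>Calculus of smooth functions\<close>

lemma partial_deriv_eqI:
  assumes "(\<phi> has_derivative D) (at x)"
  shows "partial_deriv j \<phi> x = D (axis j 1)"
  using frechet_derivative_at[OF assms] by (simp add: partial_deriv_def)

text \<open>\<open>C_k (Suc m)\<close> asks for differentiability and \<open>C_k m\<close> of the
  partials, not for \<open>C_k m\<close> itself. Descending one level therefore takes an induction,
  whose base is that differentiable functions are continuous.\<close>

lemma C_k_SucD: "C_k (Suc m) \<phi> \<Longrightarrow> C_k m \<phi>"
proof (induction m arbitrary: \<phi>)
  case 0
  then show ?case by (simp add: differentiable_imp_continuous_on)
next
  case (Suc m)
  then show ?case by (metis C_k.simps(2))
qed

lemma C_k_SucE:
  assumes "C_k (Suc m) \<phi>"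
  shows "(\<phi> has_derivative frechet_derivative \<phi> (at x)) (at x)" "C_k m (partial_deriv j \<phi>)"
  using assms by (auto simp: differentiable_on_def frechet_derivative_works)

text \<open>Any explicit derivative may replace the one chosen by \<open>frechet_derivative\<close>,
  since derivatives at a point are unique. The closure properties below become inductions on
  \<open>m\<close> through this rule.\<close>

lemma C_k_SucI:
  assumes "\<And>x. (\<phi> has_derivative D x) (at x)" "\<And>j. C_k m (\<lambda>x. D x (axis j 1))"
  shows "C_k (Suc m) \<phi>"
proof -
  have "partial_deriv j \<phi> = (\<lambda>x. D x (axis j 1))" for j
    using partial_deriv_eqI[OF assms(1)] by blast
  then show ?thesis
    using assms by (auto simp: differentiable_on_def differentiable_def)
qed

lemma C_k_const: "C_k m (\<lambda>x. c)"
proof (induction m arbitrary: c)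
  case (Suc m)
  show ?case by (rule C_k_SucI[OF has_derivative_const Suc.IH])
qed simp

lemma C_k_add:
  assumes "C_k m f" "C_k m g"
  shows "C_k m (\<lambda>x. f x + g x)"
  using assms
proof (induction m arbitrary: f g)
  case 0
  then show ?case by (simp add: continuous_on_add)
next
  case (Suc m)
  note f = C_k_SucE[OF Suc.prems(1)] and g = C_k_SucE[OF Suc.prems(2)]
  show ?case
    by (rule C_k_SucI[OF has_derivative_add[OF f(1) g(1)]])
      (use Suc.IH[OF f(2) g(2)] in \<open>simp add: partial_deriv_def\<close>)
qed

lemma C_k_mult:
  assumes "C_k m f" "C_k m g"
  shows "C_k m (\<lambda>x. f x * g x)"
  using assms
proof (induction m arbitrary: f g)
  case 0
  then show ?case by (simp add: continuous_on_mult)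
next
  case (Suc m)
  note f = C_k_SucE[OF Suc.prems(1)] and g = C_k_SucE[OF Suc.prems(2)]
  show ?case
  proof (rule C_k_SucI[OF has_derivative_mult[OF f(1) g(1)]])
    fix j
    show "C_k m (\<lambda>x. f x * frechet_derivative g (at x) (axis j 1) + frechet_derivative f (at x) (axis j 1) * g x)"
      \<comment> \<open>Each summand of the product rule keeps one factor undifferentiated; that
        factor is lowered to level \<open>m\<close> so that the induction hypothesis
        applies.\<close>
      using C_k_add[OF Suc.IH[OF C_k_SucD[OF Suc.prems(1)] g(2)] Suc.IH[OF f(2) C_k_SucD[OF Suc.prems(2)]]]
      by (simp add: partial_deriv_def)
  qed
qed

lemma C_k_prod:
  assumes "finite I" "\<And>i. i \<in> I \<Longrightarrow> C_k m (f i)"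
  shows "C_k m (\<lambda>x. \<Prod>i\<in>I. f i x)"
  using assms by (induction I rule: finite_induct) (auto intro: C_k_const C_k_mult)

lemma C_k_cnj:
  assumes "C_k m f"
  shows "C_k m (\<lambda>x. cnj (f x))"
  using assms
proof (induction m arbitrary: f)
  case 0
  then show ?case by (simp add: continuous_on_cnj)
next
  case (Suc m)
  note f = C_k_SucE[OF Suc.prems]
  show ?case
    by (rule C_k_SucI[OF bounded_linear.has_derivative[OF bounded_linear_cnj f(1)]])
      (use Suc.IH[OF f(2)] in \<open>simp add: partial_deriv_def\<close>)
qed

text \<open>For \<open>c > 0\<close> the functions \<open>s \<mapsto> exp (- c / s) / s ^ m\<close>, extended by zero to \<open>s \<le> 0\<close>, have derivatives
  in their own linear span, so smoothness follows by an induction over all \<open>m\<close> at once.\<close>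

definition flat :: "real \<Rightarrow> nat \<Rightarrow> real \<Rightarrow> real" where
  "flat c m s = (if s > 0 then exp (- (c / s)) / s ^ m else 0)"

text \<open>With \<open>x = c / s\<close>, which tends to infinity, the expression is
  \<open>x ^ m / exp x\<close> up to the constant \<open>1 / c ^ m\<close>, and the exponential
  beats every power.\<close>

lemma tendsto_exp_inverse_div_power:
  assumes "c > 0"
  shows "((\<lambda>s::real. exp (- (c / s)) / s ^ m) \<longlongrightarrow> 0) (at_right 0)"
proof -
  have "filterlim (\<lambda>s. c / s) at_top (at_right 0)"
    using filterlim_tendsto_pos_mult_at_top[OF tendsto_const assms filterlim_inverse_at_top_right]
    by (simp add: divide_inverse)
  from filterlim_compose[OF tendsto_power_div_exp_0 this]
  have "((\<lambda>s. (c / s) ^ m / exp (c / s)) \<longlongrightarrow> 0) (at_right 0)" .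
  then have "((\<lambda>s. (1 / c ^ m) * ((c / s) ^ m / exp (c / s))) \<longlongrightarrow> 0) (at_right 0)"
    by (rule tendsto_mult_right_zero)
  then show ?thesis
    using assms by (simp add: exp_minus field_simps)
qed

text \<open>For \<open>s > 0\<close> this is the quotient rule: differentiating
  \<open>- c / s\<close> brings out \<open>c / s ^ 2\<close>, raising the index by 2, and
  differentiating the power raises it by 1. Only \<open>s = 0\<close> needs a limit.\<close>

lemma has_real_derivative_flat:
  assumes "c > 0"
  shows "(flat c m has_real_derivative c * flat c (m + 2) s - m * flat c (m + 1) s) (at s)"
proof -
  consider "s > 0" | "s < 0" | "s = 0" by linarith
  then show ?thesis
  proof cases
    case 1
    \<comment> \<open>The derivative of \<open>s ^ m\<close> contains \<open>s ^ (m - 1)\<close>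
      with truncated subtraction. For \<open>m = 0\<close> the term carries the factor 0.\<close>
    have P: "m = 0 \<or> s ^ m = s * s ^ (m - Suc 0)"
      by (cases m) auto
    have "((\<lambda>s. exp (- (c / s)) / s ^ m) has_real_derivative
        c * flat c (m + 2) s - m * flat c (m + 1) s) (at s)"
      using 1 P by (auto intro!: derivative_eq_intros simp: flat_def field_simps power2_eq_square)
    moreover have "\<forall>\<^sub>F y in nhds s. flat c m y = exp (- (c / y)) / y ^ m"
      using eventually_nhds_in_open[OF open_greaterThan, of s 0] 1
      by (auto elim!: eventually_mono simp: flat_def)
    ultimately show ?thesis
      using DERIV_cong_ev by fast
  next
    case 2
    have "\<forall>\<^sub>F y in nhds s. flat c m y = 0"
      using eventually_nhds_in_open[OF open_lessThan, of s 0] 2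
      by (auto elim!: eventually_mono simp: flat_def)
    then show ?thesis
      using DERIV_cong_ev[of s s "flat c m" "\<lambda>_. 0" 0] 2 by (simp add: flat_def)
  next
    case 3
    \<comment> \<open>Since \<open>flat c m 0 = 0\<close>, the difference quotient from the right is
      the function of index \<open>Suc m\<close>, which tends to 0 as well.\<close>
    have "((\<lambda>h. flat c m h / h) \<longlongrightarrow> 0) (at_right 0)"
      using tendsto_exp_inverse_div_power[OF assms, of "Suc m"]
      by (rule Lim_transform_eventually)
        (auto simp: flat_def eventually_at_right_less[THEN eventually_mono] field_simps)
    moreover have "((\<lambda>h. flat c m h / h) \<longlongrightarrow> 0) (at_left 0)"
      by (rule tendsto_eventually)
        (auto simp: flat_def eventually_at_filter)
    ultimately have "((\<lambda>h. flat c m h / h) \<longlongrightarrow> 0) (at 0)"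
      by (simp add: filterlim_at_split)
    then show ?thesis
      using 3 by (simp add: DERIV_def flat_def)
  qed
qed

text \<open>The affine argument covers both \<open>x $ i - a $ i\<close> and
  \<open>b $ i - x $ i\<close>, which cut out a box. The index \<open>m\<close> is arbitrary in the
  induction because differentiation moves it to \<open>m + 1\<close> and
  \<open>m + 2\<close>.\<close>

lemma C_k_flat:
  assumes "c > 0"
  shows "C_k k (\<lambda>x. complex_of_real (flat c m (\<sigma> * x $ i + d)))"
proof (induction k arbitrary: m)
  case 0
  have "continuous_on UNIV (flat c m)"
    by (meson DERIV_continuous_on has_real_derivative_flat[OF assms] has_field_derivative_at_within)
  then have "continuous_on UNIV (\<lambda>x. flat c m (\<sigma> * x $ i + d))"
    by (rule continuous_on_compose2) (auto intro!: continuous_intros)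
  then show ?case by (auto intro: continuous_on_of_real)
next
  case (Suc k)
  let ?D = "\<lambda>x. c * flat c (m + 2) (\<sigma> * x $ i + d) - m * flat c (m + 1) (\<sigma> * x $ i + d)"
  show ?case
  proof (rule C_k_SucI)
    fix x
    have "((\<lambda>x. \<sigma> * x $ i + d) has_derivative (\<lambda>y. \<sigma> * y $ i)) (at x)"
      by (auto intro!: derivative_eq_intros bounded_linear.has_derivative[OF bounded_linear_vec_nth])
    from has_derivative_compose[OF this has_real_derivative_flat[OF assms, unfolded has_field_derivative_def]]
    show "((\<lambda>x. complex_of_real (flat c m (\<sigma> * x $ i + d))) has_derivative
        (\<lambda>y. complex_of_real (?D x * (\<sigma> * y $ i)))) (at x)"
      by (rule bounded_linear.has_derivative[OF bounded_linear_of_real])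
  next
    fix j
    have "C_k k (\<lambda>x. of_real (\<sigma> * axis j 1 $ i) * (of_real c * of_real (flat c (m + 2) (\<sigma> * x $ i + d))
        + of_real (- real m) * complex_of_real (flat c (m + 1) (\<sigma> * x $ i + d))))"
      by (intro C_k_mult C_k_add C_k_const Suc.IH)
    then show "C_k k (\<lambda>x. complex_of_real (?D x * (\<sigma> * axis j 1 $ i)))"
      by (simp add: algebra_simps)
  qed
qed

section \<open>Test functions\<close>

lemma test_functionsI:
  assumes "\<And>m. C_k m \<phi>" "compact K" "K \<subseteq> \<Omega>" "\<And>x. x \<notin> K \<Longrightarrow> \<phi> x = 0"
  shows "\<phi> \<in> test_functions \<Omega>"
proof -
  have K: "closure {x. \<phi> x \<noteq> 0} \<subseteq> K"
    using assms(2,4) by (intro closure_minimal) (auto intro: compact_imp_closed)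
  then have "bounded (closure {x. \<phi> x \<noteq> 0})"
    using bounded_subset compact_imp_bounded[OF assms(2)] by blast
  then show ?thesis
    using assms(1,3) K by (auto simp: test_functions_def compact_eq_bounded_closed)
qed

lemma test_functionsE:
  assumes "\<phi> \<in> test_functions \<Omega>"
  obtains K where "\<And>m. C_k m \<phi>" "compact K" "K \<subseteq> \<Omega>" "\<And>x. x \<notin> K \<Longrightarrow> \<phi> x = 0"
proof
  show "C_k m \<phi>" "compact (closure {x. \<phi> x \<noteq> 0})" "closure {x. \<phi> x \<noteq> 0} \<subseteq> \<Omega>" for m
    using assms by (auto simp: test_functions_def)
  show "\<phi> x = 0" if "x \<notin> closure {x. \<phi> x \<noteq> 0}" for x
    using that closure_subset[of "{x. \<phi> x \<noteq> 0}"] by auto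
qed

text \<open>Differentiation does not enlarge the support: off the compact set \<open>K\<close> the
  function vanishes on an open set, so its derivative vanishes there too.\<close>

lemma test_functions_partial_deriv:
  assumes "\<phi> \<in> test_functions \<Omega>"
  shows "partial_deriv j \<phi> \<in> test_functions \<Omega>"
proof -
  obtain K where K: "\<And>m. C_k m \<phi>" "compact K" "K \<subseteq> \<Omega>" "\<And>x. x \<notin> K \<Longrightarrow> \<phi> x = 0"
    using test_functionsE[OF assms] by blast
  have "partial_deriv j \<phi> x = 0" if "x \<notin> K" for x
  proof -
    have "(\<phi> has_derivative (\<lambda>_. 0)) (at x)"
      by (rule has_derivative_transform_within_open[OF has_derivative_const, of "- K"])
        (use that K open_Compl[OF compact_imp_closed[OF K(2)]] in auto)
    then show ?thesis by (simp add: partial_deriv_eqI)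
  qed
  moreover have "C_k m (partial_deriv j \<phi>)" for m
    using C_k_SucE(2)[OF K(1)] .
  ultimately show ?thesis
    using K by (intro test_functionsI)
qed

lemma test_functions_mult:
  assumes "\<phi> \<in> test_functions \<Omega>" "\<And>m. C_k m \<psi>"
  shows "(\<lambda>x. \<phi> x * \<psi> x) \<in> test_functions \<Omega>"
proof -
  obtain K where K: "\<And>m. C_k m \<phi>" "compact K" "K \<subseteq> \<Omega>" "\<And>x. x \<notin> K \<Longrightarrow> \<phi> x = 0"
    using test_functionsE[OF assms(1)] by blast
  show ?thesis
    by (rule test_functionsI[OF C_k_mult K(2,3)]) (use K assms(2) in auto)
qed

lemma test_functions_cnj:
  "\<phi> \<in> test_functions \<Omega> \<Longrightarrow> (\<lambda>x. cnj (\<phi> x)) \<in> test_functions \<Omega>"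
  by (simp add: test_functions_def C_k_cnj)

lemma test_functions_has_derivative:
  assumes "\<phi> \<in> test_functions \<Omega>"
  shows "(\<phi> has_derivative frechet_derivative \<phi> (at x)) (at x)"
  using assms C_k_SucE(1)[of 0 \<phi>] by (auto simp: test_functions_def)

lemma test_functions_continuous_on:
  assumes "\<phi> \<in> test_functions \<Omega>"
  shows "continuous_on S \<phi>"
proof -
  have "C_k 0 \<phi>" using assms unfolding test_functions_def by blast
  then show ?thesis using continuous_on_subset by auto
qed

text \<open>The bumps are products over the coordinates of \<open>exp (- 1 / (n s))\<close>, which tends to 1 for every \<open>s > 0\<close>.\<close>

lemma bump_approximation:
  fixes a b :: "real^'n"
  assumes "cbox a b \<subseteq> \<Omega>"
  obtains \<phi> where "\<And>n::nat. \<phi> n \<in> test_functions \<Omega>" "\<And>n x. cmod (\<phi> n x) \<le> 1"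
    "\<And>x. (\<lambda>n. \<phi> n x) \<longlonglongrightarrow> indicator (box a b) x"
proof
  \<comment> \<open>\<open>Suc n\<close> keeps the parameter positive: for parameter 0 the function
    would be the discontinuous indicator of the positive half-line.\<close>
  let ?F = "\<lambda>n s. flat (1 / Suc n) 0 s"
  define \<phi> where "\<phi> n x = (\<Prod>i\<in>UNIV. complex_of_real (?F n (1 * x $ i + - a $ i))
    * complex_of_real (?F n (-1 * x $ i + b $ i)))" for n x
  have F: "0 \<le> ?F n s" "?F n s \<le> 1" for n s by (auto simp: flat_def)
  show "\<phi> n \<in> test_functions \<Omega>" for n
  proof -
    \<comment> \<open>A nonzero product has all factors nonzero, so all arguments are positive. The
      support thus lies in the compact \<open>cbox a b\<close>, hence in \<Omega>.\<close>
    have "x \<in> cbox a b" if "\<phi> n x \<noteq> 0" for x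
    proof -
      have "?F n (x $ i - a $ i) \<noteq> 0" "?F n (b $ i - x $ i) \<noteq> 0" for i
        using that by (auto simp: \<phi>_def)
      then show ?thesis
        by (auto simp: mem_box_cart flat_def split: if_splits) (metis less_eq_real_def)+
    qed
    moreover have "C_k m (\<phi> n)" for m
      unfolding \<phi>_def by (intro C_k_prod C_k_mult C_k_flat) auto
    ultimately show ?thesis
      using assms by (intro test_functionsI[OF _ compact_cbox]) auto
  qed
  show "cmod (\<phi> n x) \<le> 1" for n x
    unfolding \<phi>_def prod_norm[symmetric] norm_mult norm_of_real
    by (intro prod_le_1) (use F in \<open>auto intro!: mult_le_one\<close>)
  have lim: "(\<lambda>n. ?F n s) \<longlonglongrightarrow> indicator {0<..} s" for s
  proof (cases "s > 0")
    case True
    have "(\<lambda>n. exp (- (1 / real (Suc n) / s))) \<longlonglongrightarrow> exp (- (0 / s))"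
      using True by (intro tendsto_intros LIMSEQ_Suc[OF lim_1_over_n]) auto
    then show ?thesis using True by (simp add: flat_def)
  qed (simp add: flat_def)
  show "(\<lambda>n. \<phi> n x) \<longlonglongrightarrow> indicator (box a b) x" for x
  proof -
    have "(\<lambda>n. \<phi> n x) \<longlonglongrightarrow> (\<Prod>i\<in>UNIV. complex_of_real (indicator {0<..} (1 * x $ i + - a $ i))
       * complex_of_real (indicator {0<..} (-1 * x $ i + b $ i)))"
      unfolding \<phi>_def by (intro tendsto_intros lim)
    moreover have "(\<Prod>i\<in>UNIV. complex_of_real (indicator {0<..} (1 * x $ i + - a $ i))
       * complex_of_real (indicator {0<..} (-1 * x $ i + b $ i))) = indicator (box a b) x"
      by (auto simp: indicator_def mem_box_cart)
    ultimately show ?thesis by simp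
  qed
qed

section \<open>The fundamental lemma of the calculus of variations\<close>

text \<open>By Lebesgue differentiation, \<open>f\<close> is almost everywhere the limit of its means over shrinking cubes.\<close>

lemma AE_zero_if_integral_cbox_zero:
  fixes f :: "real^'n \<Rightarrow> complex"
  assumes "open \<Omega>" and f: "integrable (lebesgue_on \<Omega>) f"
    and zero: "\<And>a b. cbox a b \<subseteq> \<Omega> \<Longrightarrow> (LINT x|lebesgue. indicator (box a b) x * f x) = 0"
  shows "AE x in lebesgue_on \<Omega>. f x = 0"
proof -
  let ?g = "\<lambda>x. if x \<in> \<Omega> then f x else 0"
  have \<Omega>: "\<Omega> \<in> sets lebesgue" using \<open>open \<Omega>\<close> by (simp add: lborelD)
  then have gL: "integrable lebesgue ?g"
    using f by (simp add: Lebesgue_Measure.integrable_restrict_UNIV)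
  then have "?g integrable_on UNIV"
    by (simp add: integrable_on_lebesgue)
  then have "?g integrable_on cbox a b" for a b
    using integrable_on_subcbox by blast
  \<comment> \<open>Off a null set, the means over cubes with lower corner \<open>x\<close> and side
    \<open>h\<close> converge to the value at \<open>x\<close>.\<close>
  then obtain N where N: "negligible N" "\<And>x e. \<lbrakk>x \<notin> N; 0 < e\<rbrakk> \<Longrightarrow>
      \<exists>d>0. \<forall>h. 0 < h \<and> h < d \<longrightarrow>
        norm (integral (cbox x (x + h *\<^sub>R One)) ?g /\<^sub>R h ^ DIM(real^'n) - ?g x) < e"
    by (rule integrable_ccontinuous_explicit[of ?g]) blast
  \<comment> \<open>The hypothesis concerns open boxes; the faces of a closed box are negligible,
    and inside \<Omega> the extension by zero changes nothing.\<close>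
  have int0: "integral (cbox a b) ?g = 0" if "cbox a b \<subseteq> \<Omega>" for a b
  proof -
    have "integral (cbox a b) ?g = integral (box a b) ?g"
      by (simp add: integral_open_interval)
    also have "\<dots> = integral UNIV (\<lambda>x. if x \<in> box a b then ?g x else 0)"
      by (rule integral_restrict_UNIV[symmetric])
    also have "(\<lambda>x. if x \<in> box a b then ?g x else 0) = (\<lambda>x. indicator (box a b) x * f x)"
      using that box_subset_cbox[of a b] by (auto simp: indicator_def fun_eq_iff)
    also have "integral UNIV \<dots> = (LINT x|lebesgue. indicator (box a b) x * f x)"
    proof (rule integral_lebesgue)
      have "integrable lebesgue (\<lambda>x. indicator (box a b) x *\<^sub>R ?g x)"
        by (intro integrable_mult_indicator gL) auto
      moreover have "indicator (box a b) x *\<^sub>R ?g x = indicator (box a b) x * f x" for x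
        using that box_subset_cbox[of a b] by (auto simp: indicator_def)
      ultimately show "integrable lebesgue (\<lambda>x. indicator (box a b) x * f x)" by simp
    qed
    finally show ?thesis using zero[OF that] by simp
  qed
  have "f x = 0" if x: "x \<in> \<Omega>" "x \<notin> N" for x
  proof -
    have "norm (?g x) < e" if "e > 0" for e
    proof -
      obtain d where d: "d > 0" "\<And>h. 0 < h \<Longrightarrow> h < d \<Longrightarrow>
          norm (integral (cbox x (x + h *\<^sub>R One)) ?g /\<^sub>R h ^ DIM(real^'n) - ?g x) < e"
        using N(2)[OF x(2) \<open>e > 0\<close>] by blast
      obtain r where r: "r > 0" "ball x r \<subseteq> \<Omega>"
        using \<open>open \<Omega>\<close> x(1) openE by blast
      \<comment> \<open>A cube of side \<open>h\<close> has diameter \<open>h * norm One\<close>, so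
        \<open>h < r / c\<close> keeps it inside the ball. Adding 1 makes \<open>c\<close> evidently
        positive.\<close>
      define c where "c = norm (One :: real^'n) + 1"
      have c: "c > 0" by (simp add: c_def add_nonneg_pos)
      then obtain h where h: "0 < h" "h < d" "h < r / c"
        using field_lbound_gt_zero[of d "r / c"] d(1) r(1) by auto
      have "cbox x (x + h *\<^sub>R One) \<subseteq> ball x r"
      proof
        fix y assume y: "y \<in> cbox x (x + h *\<^sub>R One)"
        have "norm (y - x) \<le> norm (h *\<^sub>R One :: real^'n)"
          by (rule norm_le_componentwise) (use y in \<open>auto simp: mem_box inner_simps\<close>)
        also have "\<dots> = h * norm (One :: real^'n)" using h by simp
        also have "\<dots> \<le> h * c" using h by (simp add: c_def)
        also have "\<dots> < r" using h c by (simp add: field_simps)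
        finally show "y \<in> ball x r" by (simp add: dist_norm norm_minus_commute)
      qed
      then have "integral (cbox x (x + h *\<^sub>R One)) ?g = 0"
        using r(2) by (intro int0) blast
      then show ?thesis using d(2)[OF h(1,2)] by (metis (no_types, lifting) norm_minus_cancel diff_0 scaleR_zero_right)
    qed
    then have "?g x = 0" by (metis less_irrefl zero_less_norm_iff)
    then show ?thesis using x by simp
  qed
  moreover have "AE x in lebesgue. x \<notin> N"
    using N(1) by (intro AE_not_in) (simp add: negligible_iff_null_sets)
  ultimately show ?thesis
    using \<Omega> by (subst AE_restrict_space_iff) (auto elim!: eventually_mono)
qed

text \<open>The bumps are bounded by 1 and tend to the indicator of an open box. Dominated
  convergence with bound \<open>cmod (f x)\<close> shows that the integrals of \<open>f\<close> over
  boxes vanish, which reduces the claim to the preceding lemma.\<close>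

proposition fundamental_lemma_calculus_of_variations:
  fixes f :: "real^'n \<Rightarrow> complex"
  assumes "open \<Omega>" and f: "integrable (lebesgue_on \<Omega>) f"
    and zero: "\<And>\<phi>. \<phi> \<in> test_functions \<Omega> \<Longrightarrow> regular_distr \<Omega> f \<phi> = 0"
  shows "AE x in lebesgue_on \<Omega>. f x = 0"
proof (rule AE_zero_if_integral_cbox_zero[OF assms(1,2)])
  fix a b :: "real^'n" assume ab: "cbox a b \<subseteq> \<Omega>"
  obtain \<phi> where \<phi>: "\<And>n::nat. \<phi> n \<in> test_functions \<Omega>" "\<And>n x. cmod (\<phi> n x) \<le> 1"
    "\<And>x. (\<lambda>n. \<phi> n x) \<longlonglongrightarrow> indicator (box a b) x"
    using bump_approximation[OF ab] by blast
  have \<Omega>: "\<Omega> \<in> sets lebesgue" using \<open>open \<Omega>\<close> by (simp add: lborelD)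
  have cont: "\<phi> n \<in> borel_measurable (lebesgue_on \<Omega>)" for n
    by (intro continuous_imp_measurable_on_sets_lebesgue test_functions_continuous_on[OF \<phi>(1)] \<Omega>)
  have ind: "(indicator (box a b) :: _ \<Rightarrow> complex) \<in> borel_measurable (lebesgue_on \<Omega>)"
    by (rule borel_measurable_LIMSEQ_metric[OF cont \<phi>(3)])
  have "(\<lambda>n. LINT x|lebesgue_on \<Omega>. f x * \<phi> n x) \<longlonglongrightarrow> (LINT x|lebesgue_on \<Omega>. f x * indicator (box a b) x)"
  proof (rule integral_dominated_convergence)
    show "integrable (lebesgue_on \<Omega>) (\<lambda>x. cmod (f x))" using f by simp
    show "AE x in lebesgue_on \<Omega>. (\<lambda>n. f x * \<phi> n x) \<longlonglongrightarrow> f x * indicator (box a b) x"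
      by (intro AE_I2 tendsto_mult tendsto_const \<phi>(3))
    show "AE x in lebesgue_on \<Omega>. cmod (f x * \<phi> n x) \<le> cmod (f x)" for n
      using \<phi>(2) by (intro AE_I2) (simp add: norm_mult mult_left_le)
  qed (use f cont ind in auto)
  moreover have "(LINT x|lebesgue_on \<Omega>. f x * \<phi> n x) = 0" for n
    using zero[OF \<phi>(1)] by (simp add: regular_distr_def)
  ultimately have "(LINT x|lebesgue_on \<Omega>. f x * indicator (box a b) x) = 0"
    by (simp add: LIMSEQ_const_iff)
  moreover have "(LINT x|lebesgue_on \<Omega>. f x * indicator (box a b) x)
      = (LINT x|lebesgue. (if x \<in> \<Omega> then f x * indicator (box a b) x else 0))"
    using \<Omega> by (simp add: Lebesgue_Measure.integral_restrict_UNIV)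
  moreover have "(\<lambda>x. if x \<in> \<Omega> then f x * indicator (box a b) x else 0) = (\<lambda>x. indicator (box a b) x * f x)"
    using ab box_subset_cbox[of a b] by (auto simp: indicator_def fun_eq_iff)
  ultimately show "(LINT x|lebesgue. indicator (box a b) x * f x) = 0"
    by simp
qed

section \<open>Integration by parts\<close>

lemma test_functions_lborel_integrable:
  assumes "\<phi> \<in> test_functions \<Omega>"
  shows "integrable lborel \<phi>"
proof -
  obtain K where "\<And>m. C_k m \<phi>" and K: "compact K" and "K \<subseteq> \<Omega>" and K0: "\<And>x. x \<notin> K \<Longrightarrow> \<phi> x = 0"
    by (rule test_functionsE[OF assms]) (rule that)
  have "integrable lborel (\<lambda>x. indicator K x *\<^sub>R \<phi> x)"
    using borel_integrable_compact[OF K test_functions_continuous_on[OF assms]] by simp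
  moreover have "(\<lambda>x. indicator K x *\<^sub>R \<phi> x) = \<phi>"
    using K0 by (auto simp: indicator_def)
  ultimately show ?thesis by simp
qed

lemma test_functions_bounded:
  assumes "\<phi> \<in> test_functions \<Omega>"
  obtains B where "B > 0" "\<And>x. cmod (\<phi> x) \<le> B"
proof -
  obtain K where "\<And>m. C_k m \<phi>" and K: "compact K" and "K \<subseteq> \<Omega>" and K0: "\<And>x. x \<notin> K \<Longrightarrow> \<phi> x = 0"
    by (rule test_functionsE[OF assms]) (rule that)
  have "bounded (\<phi> ` K)"
    by (intro compact_imp_bounded compact_continuous_image test_functions_continuous_on[OF assms] K)
  then obtain B where B: "B > 0" "\<forall>x\<in>K. cmod (\<phi> x) \<le> B"
    by (auto simp: bounded_pos)
  have "cmod (\<phi> x) \<le> B" for x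
    using B K0[of x] by (cases "x \<in> K") auto
  with B(1) show ?thesis by (rule that)
qed

lemma partial_deriv_has_vector_derivative:
  assumes "\<phi> \<in> test_functions \<Omega>"
  shows "((\<lambda>t. \<phi> (x + t *\<^sub>R axis j 1)) has_vector_derivative partial_deriv j \<phi> (x + t *\<^sub>R axis j 1)) (at t within S)"
proof -
  let ?D = "frechet_derivative \<phi> (at (x + t *\<^sub>R axis j 1))"
  have D: "(\<phi> has_derivative ?D) (at (x + t *\<^sub>R axis j 1))"
    by (rule test_functions_has_derivative[OF assms])
  have "((\<lambda>t. x + t *\<^sub>R axis j 1) has_derivative (\<lambda>s. s *\<^sub>R axis j (1::real))) (at t within S)"
    by (auto intro!: derivative_eq_intros)
  from has_derivative_compose[OF this D]
  have "((\<lambda>t. \<phi> (x + t *\<^sub>R axis j 1)) has_derivative (\<lambda>s. ?D (s *\<^sub>R axis j 1))) (at t within S)" .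
  then show ?thesis
    using linear_scale[OF has_derivative_linear[OF D]]
    by (simp add: has_vector_derivative_def partial_deriv_def)
qed

text \<open>The mean value inequality along a coordinate direction; it bounds difference quotients
  independently of the step, as dominated convergence requires.\<close>

lemma test_functions_increment_bound:
  assumes "\<phi> \<in> test_functions \<Omega>" "\<And>x. cmod (partial_deriv j \<phi> x) \<le> B" "t \<ge> 0"
  shows "cmod (\<phi> (x + t *\<^sub>R axis j 1) - \<phi> x) \<le> B * t"
proof -
  have "cmod (\<phi> (x + t *\<^sub>R axis j 1) - \<phi> (x + 0 *\<^sub>R axis j 1)) \<le> B * norm (t - 0)"
  proof (rule differentiable_bound[where S = "{0..t}"])
    fix s show "((\<lambda>t. \<phi> (x + t *\<^sub>R axis j 1)) has_derivative (\<lambda>r. r *\<^sub>R partial_deriv j \<phi> (x + s *\<^sub>R axis j 1)))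
        (at s within {0..t})"
      using partial_deriv_has_vector_derivative[OF assms(1)] by (simp add: has_vector_derivative_def)
    show "onorm (\<lambda>r. r *\<^sub>R partial_deriv j \<phi> (x + s *\<^sub>R axis j 1)) \<le> B"
      by (intro onorm_le) (simp add: assms(2) mult.commute[of B] mult_left_mono)
  qed (use assms in auto)
  then show ?thesis using assms(3) by simp
qed

text \<open>By translation invariance all difference quotients of \<open>\<phi>\<close> have integral zero; dominated
  convergence passes this on to the partial derivative.\<close>

lemma lborel_integral_partial_deriv_zero:
  fixes \<phi> :: "real^'n \<Rightarrow> complex"
  assumes \<phi>: "\<phi> \<in> test_functions \<Omega>"
  shows "(LINT x|lborel. partial_deriv j \<phi> x) = 0"
proof -
  define q where "q n x = real (Suc n) *\<^sub>R (\<phi> (x + (1 / real (Suc n)) *\<^sub>R axis j 1) - \<phi> x)" for n x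
  obtain B where B: "B > 0" "\<And>x. cmod (partial_deriv j \<phi> x) \<le> B"
    by (rule test_functions_bounded[OF test_functions_partial_deriv[OF \<phi>, of j]]) (rule that)
  obtain K where "\<And>m. C_k m \<phi>" and K: "compact K" and "K \<subseteq> \<Omega>" and K0: "\<And>x. x \<notin> K \<Longrightarrow> \<phi> x = 0"
    by (rule test_functionsE[OF \<phi>]) (rule that)
  obtain R where R: "\<And>x. x \<in> K \<Longrightarrow> norm x \<le> R"
    using compact_imp_bounded[OF K] by (auto simp: bounded_iff)
  have int: "integrable lborel \<phi>" by (rule test_functions_lborel_integrable[OF \<phi>])
  have shift: "integrable lborel (\<lambda>x. \<phi> (x + a))" "(LINT x|lborel. \<phi> (x + a)) = (LINT x|lborel. \<phi> x)" for a
  proof -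
    have d: "distr lborel borel ((+) a) = lborel" by (rule lborel_distr_plus)
    have m: "\<phi> \<in> borel_measurable borel" using int by auto
    show "integrable lborel (\<lambda>x. \<phi> (x + a))"
      using integrable_distr_eq[of "(+) a" lborel borel \<phi>] int m d by (simp add: add.commute)
    show "(LINT x|lborel. \<phi> (x + a)) = (LINT x|lborel. \<phi> x)"
      using integral_distr[of "(+) a" lborel borel \<phi>] m d by (simp add: add.commute)
  qed
  have q_int: "(LINT x|lborel. q n x) = 0" for n
    unfolding q_def using int shift by simp
  have q_lim: "(\<lambda>n. q n x) \<longlonglongrightarrow> partial_deriv j \<phi> x" for x
  proof -
    have "((\<lambda>t. \<phi> (x + t *\<^sub>R axis j 1)) has_vector_derivative partial_deriv j \<phi> x) (at 0)"
      using partial_deriv_has_vector_derivative[OF \<phi>, of x j 0 UNIV] by simp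
    then have "((\<lambda>h. cmod (\<phi> (x + h *\<^sub>R axis j 1) - \<phi> x - h *\<^sub>R partial_deriv j \<phi> x) / norm h) \<longlongrightarrow> 0) (at 0)"
      by (simp add: has_vector_derivative_def has_derivative_at)
    moreover have "\<forall>\<^sub>F h in at 0. cmod (\<phi> (x + h *\<^sub>R axis j 1) - \<phi> x - h *\<^sub>R partial_deriv j \<phi> x) / norm h
        = cmod ((\<phi> (x + h *\<^sub>R axis j 1) - \<phi> x) /\<^sub>R h - partial_deriv j \<phi> x)"
    proof (rule eventually_at_filter[THEN iffD2], intro always_eventually allI impI)
      fix h :: real assume "h \<noteq> 0"
      then have "(\<phi> (x + h *\<^sub>R axis j 1) - \<phi> x) /\<^sub>R h - partial_deriv j \<phi> x
          = (\<phi> (x + h *\<^sub>R axis j 1) - \<phi> x - h *\<^sub>R partial_deriv j \<phi> x) /\<^sub>R h"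
        by (simp add: scaleR_diff_right)
      then show "cmod (\<phi> (x + h *\<^sub>R axis j 1) - \<phi> x - h *\<^sub>R partial_deriv j \<phi> x) / norm h
        = cmod ((\<phi> (x + h *\<^sub>R axis j 1) - \<phi> x) /\<^sub>R h - partial_deriv j \<phi> x)"
        by (simp add: divide_inverse mult.commute)
    qed
    ultimately have "((\<lambda>h. cmod ((\<phi> (x + h *\<^sub>R axis j 1) - \<phi> x) /\<^sub>R h - partial_deriv j \<phi> x)) \<longlongrightarrow> 0) (at 0)"
      by (rule Lim_transform_eventually)
    then have "((\<lambda>h. (\<phi> (x + h *\<^sub>R axis j 1) - \<phi> x) /\<^sub>R h) \<longlongrightarrow> partial_deriv j \<phi> x) (at 0)"
      by (rule LIM_zero_cancel[OF tendsto_norm_zero_cancel])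
    moreover have "filterlim (\<lambda>n. 1 / real (Suc n)) (at 0) sequentially"
      unfolding filterlim_at by (intro conjI LIMSEQ_Suc[OF lim_1_over_n] always_eventually) auto
    ultimately have "(\<lambda>n. (\<phi> (x + (1 / real (Suc n)) *\<^sub>R axis j 1) - \<phi> x) /\<^sub>R (1 / real (Suc n)))
        \<longlonglongrightarrow> partial_deriv j \<phi> x"
      by (rule filterlim_compose)
    then show ?thesis by (simp add: q_def)
  qed
  \<comment> \<open>The steps are at most 1 and \<open>K\<close> lies in the ball of radius
    \<open>R\<close>. Outside the ball of radius \<open>R + 1\<close> both points of the quotient
    therefore miss \<open>K\<close>.\<close>
  have q_bound: "cmod (q n x) \<le> indicator (cball 0 (R + 1)) x * B" for n x
  proof (cases "x \<in> cball 0 (R + 1)")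
    case True
    have "cmod (q n x) \<le> real (Suc n) * (B * (1 / real (Suc n)))"
      unfolding q_def norm_scaleR abs_of_nat
      by (intro mult_left_mono test_functions_increment_bound[OF \<phi> B(2)]) auto
    then show ?thesis using True by simp
  next
    case False
    have "norm x \<le> norm (x + (1 / real (Suc n)) *\<^sub>R axis j 1) + norm ((1 / real (Suc n)) *\<^sub>R axis j (1::real))"
      by (metis add_diff_cancel norm_triangle_ineq4)
    moreover have "norm ((1 / real (Suc n)) *\<^sub>R axis j (1::real)) \<le> 1" by (simp add: norm_axis_1)
    ultimately have "\<not> norm x \<le> R" "\<not> norm (x + (1 / real (Suc n)) *\<^sub>R axis j 1) \<le> R"
      using False unfolding mem_cball_0 by linarith+
    then have "x \<notin> K" "x + (1 / real (Suc n)) *\<^sub>R axis j 1 \<notin> K"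
      using R by blast+
    then show ?thesis using K0 False by (simp add: q_def)
  qed
  have "(\<lambda>n. LINT x|lborel. q n x) \<longlonglongrightarrow> (LINT x|lborel. partial_deriv j \<phi> x)"
  proof (rule integral_dominated_convergence)
    show "integrable lborel (\<lambda>x::real^'n. indicator (cball 0 (R + 1)) x * B)"
      using borel_integrable_compact[of "cball (0::real^'n) (R + 1)" "\<lambda>_. B"] by simp
    show "q n \<in> borel_measurable lborel" for n
      unfolding q_def using shift(1) int by (intro borel_measurable_scaleR borel_measurable_diff) auto
    show "partial_deriv j \<phi> \<in> borel_measurable lborel"
      using test_functions_lborel_integrable[OF test_functions_partial_deriv[OF \<phi>]] by auto
  qed (use q_lim q_bound in auto)
  then show ?thesis
    by (simp add: q_int LIMSEQ_const_iff)
qed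

text \<open>Test functions vanish outside \<Omega>, so integrals over \<Omega> become integrals over
  the whole space, where translation invariance is available.\<close>

lemma test_functions_integrable:
  fixes \<phi> :: "real^'n \<Rightarrow> complex"
  assumes "open \<Omega>" and \<phi>: "\<phi> \<in> test_functions \<Omega>"
  shows "integrable (lebesgue_on \<Omega>) \<phi>" "(LINT x|lebesgue_on \<Omega>. \<phi> x) = (LINT x|lborel. \<phi> x)"
proof -
  have \<Omega>: "\<Omega> \<in> sets lebesgue" using \<open>open \<Omega>\<close> by (simp add: lborelD)
  have z: "(\<lambda>x. if x \<in> \<Omega> then \<phi> x else 0) = \<phi>"
    using \<phi> closure_subset[of "{x. \<phi> x \<noteq> 0}"] by (auto simp: test_functions_def fun_eq_iff)
  have int: "integrable lborel \<phi>" by (rule test_functions_lborel_integrable[OF \<phi>])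
  then have "integrable lebesgue \<phi>" by (simp add: integrable_completion)
  then show "integrable (lebesgue_on \<Omega>) \<phi>"
    using Lebesgue_Measure.integrable_restrict_UNIV[OF \<Omega>, of \<phi>] z by simp
  show "(LINT x|lebesgue_on \<Omega>. \<phi> x) = (LINT x|lborel. \<phi> x)"
    using Lebesgue_Measure.integral_restrict_UNIV[OF \<Omega>, of \<phi>] z int by (simp add: integral_completion)
qed

text \<open>The product of the two functions is a test function, so its partial derivative
  integrates to zero; the product rule splits that integral. No boundary term arises because the
  supports are compact in \<Omega>.\<close>

lemma test_functions_integration_by_parts:
  assumes "open \<Omega>" and \<phi>: "\<phi> \<in> test_functions \<Omega>" and \<psi>: "\<psi> \<in> test_functions \<Omega>"
  shows "(LINT x|lebesgue_on \<Omega>. partial_deriv j \<phi> x * \<psi> x) = - (LINT x|lebesgue_on \<Omega>. \<phi> x * partial_deriv j \<psi> x)"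
proof -
  have C: "C_k m \<theta>" if "\<theta> \<in> test_functions \<Omega>" for m \<theta>
    using that by (auto simp: test_functions_def)
  note d = test_functions_partial_deriv
  have t: "(\<lambda>x. \<phi> x * \<psi> x) \<in> test_functions \<Omega>" "(\<lambda>x. partial_deriv j \<phi> x * \<psi> x) \<in> test_functions \<Omega>"
    "(\<lambda>x. \<phi> x * partial_deriv j \<psi> x) \<in> test_functions \<Omega>"
    using \<phi> \<psi> d C by (blast intro: test_functions_mult)+
  have "partial_deriv j (\<lambda>x. \<phi> x * \<psi> x) x = \<phi> x * partial_deriv j \<psi> x + partial_deriv j \<phi> x * \<psi> x" for x
    using partial_deriv_eqI[OF has_derivative_mult[OF test_functions_has_derivative[OF \<phi>] test_functions_has_derivative[OF \<psi>]]]
    by (simp add: partial_deriv_def)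
  then have "0 = (LINT x|lebesgue_on \<Omega>. \<phi> x * partial_deriv j \<psi> x + partial_deriv j \<phi> x * \<psi> x)"
    using lborel_integral_partial_deriv_zero[OF t(1), of j] test_functions_integrable(2)[OF \<open>open \<Omega>\<close> d[OF t(1), of j]]
    by simp
  then show ?thesis
    using test_functions_integrable(1)[OF \<open>open \<Omega>\<close>] t by (simp add: eq_neg_iff_add_eq_0 add.commute)
qed

lemma test_functions_partial_deriv_cnj:
  assumes "\<phi> \<in> test_functions \<Omega>"
  shows "partial_deriv j (\<lambda>x. cnj (\<phi> x)) = (\<lambda>x. cnj (partial_deriv j \<phi> x))"
  using partial_deriv_eqI[OF bounded_linear.has_derivative[OF bounded_linear_cnj test_functions_has_derivative[OF assms]]]
  by (simp add: partial_deriv_def fun_eq_iff)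

lemma test_functions_partial_deriv_cmult:
  assumes "\<phi> \<in> test_functions \<Omega>"
  shows "partial_deriv j (\<lambda>x. c * \<phi> x) = (\<lambda>x. c * partial_deriv j \<phi> x)"
  using partial_deriv_eqI[OF has_derivative_mult_right[OF test_functions_has_derivative[OF assms]]]
  by (simp add: partial_deriv_def fun_eq_iff)

lemma test_functions_cmult:
  assumes "\<phi> \<in> test_functions \<Omega>"
  shows "(\<lambda>x. c * \<phi> x) \<in> test_functions \<Omega>"
  using test_functions_mult[OF assms C_k_const[of _ c]] by (simp add: mult.commute)

section \<open>Weak gradients and the energy\<close>

lemma test_functions_L2:
  assumes "open \<Omega>" "\<phi> \<in> test_functions \<Omega>"
  shows "\<phi> \<in> L2 \<Omega>"
proof -
  have "(\<lambda>x. \<phi> x * cnj (\<phi> x)) \<in> test_functions \<Omega>"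
    using assms(2) by (intro test_functions_mult C_k_cnj) (auto simp: test_functions_def)
  then have "integrable (lebesgue_on \<Omega>) (\<lambda>x. Re (\<phi> x * cnj (\<phi> x)))"
    using test_functions_integrable(1)[OF assms(1)] integrable_Re by blast
  moreover have "Re (\<phi> x * cnj (\<phi> x)) = (cmod (\<phi> x))\<^sup>2" for x
    by (metis complex_norm_square Re_complex_of_real)
  ultimately show ?thesis
    using test_functions_integrable(1)[OF assms] by (simp add: L2_def)
qed

lemma L2_measurable: "u \<in> L2 \<Omega> \<Longrightarrow> u \<in> borel_measurable (lebesgue_on \<Omega>)"
  by (simp add: L2_def)

lemma L2_cnj: "u \<in> L2 \<Omega> \<Longrightarrow> (\<lambda>x. cnj (u x)) \<in> L2 \<Omega>"
  by (auto simp: L2_def intro!: borel_measurable_continuous_on[of cnj] continuous_intros)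

lemma L2_mult_integrable:
  assumes u: "u \<in> L2 \<Omega>" and v: "v \<in> L2 \<Omega>"
  shows "integrable (lebesgue_on \<Omega>) (\<lambda>x. u x * v x)"
proof (rule Bochner_Integration.integrable_bound)
  show "integrable (lebesgue_on \<Omega>) (\<lambda>x. (cmod (u x))\<^sup>2 + (cmod (v x))\<^sup>2)"
    using assms by (simp add: L2_def)
  show "(\<lambda>x. u x * v x) \<in> borel_measurable (lebesgue_on \<Omega>)"
    using L2_measurable assms by (intro borel_measurable_times)
  have "a * b \<le> a\<^sup>2 + b\<^sup>2" if "a \<ge> 0" "b \<ge> 0" for a b :: real
    using sum_squares_bound[of a b] mult_nonneg_nonneg[OF that] by linarith
  then show "AE x in lebesgue_on \<Omega>. norm (u x * v x) \<le> norm ((cmod (u x))\<^sup>2 + (cmod (v x))\<^sup>2)"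
    by (simp add: norm_mult)
qed

lemma L2_cmod_square_integrable: "u \<in> L2 \<Omega> \<Longrightarrow> integrable (lebesgue_on \<Omega>) (\<lambda>x. (cmod (u x))\<^sup>2)"
  by (simp add: L2_def)

text \<open>On the complex numbers the real inner product of \<open>a\<close> and \<open>b\<close>
  is \<open>Re (a * cnj b)\<close>. It is the cross term when squared moduli are expanded along a
  real line.\<close>

lemma L2_inner_integrable:
  assumes "u \<in> L2 \<Omega>" "v \<in> L2 \<Omega>"
  shows "integrable (lebesgue_on \<Omega>) (\<lambda>x. u x \<bullet> v x)"
  using integrable_Re[OF L2_mult_integrable[OF assms(1) L2_cnj[OF assms(2)]]]
  by (simp add: inner_complex_def)

lemma norm_add_scaleR_square:
  fixes a b :: "'a::real_inner"
  shows "(norm (a + t *\<^sub>R b))\<^sup>2 = (norm a)\<^sup>2 + 2 * t * (a \<bullet> b) + t\<^sup>2 * (norm b)\<^sup>2"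
  by (simp add: power2_norm_eq_inner inner_simps inner_commute[of b a]) (simp add: power2_eq_square algebra_simps)

lemma L2_add_scaleR:
  assumes "u \<in> L2 \<Omega>" "v \<in> L2 \<Omega>"
  shows "(\<lambda>x. u x + t *\<^sub>R v x) \<in> L2 \<Omega>"
  unfolding L2_def mem_Collect_eq norm_add_scaleR_square
  using assms L2_measurable L2_inner_integrable[OF assms] L2_cmod_square_integrable
  by (intro conjI borel_measurable_add borel_measurable_scaleR Bochner_Integration.integrable_add
      integrable_mult_right) auto

lemma integral_cmod_add_scaleR_square:
  assumes "u \<in> L2 \<Omega>" "v \<in> L2 \<Omega>"
  shows "(LINT x|lebesgue_on \<Omega>. (cmod (u x + t *\<^sub>R v x))\<^sup>2) =
    (LINT x|lebesgue_on \<Omega>. (cmod (u x))\<^sup>2) + 2 * t * (LINT x|lebesgue_on \<Omega>. u x \<bullet> v x)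
      + t\<^sup>2 * (LINT x|lebesgue_on \<Omega>. (cmod (v x))\<^sup>2)"
  unfolding norm_add_scaleR_square
  using L2_inner_integrable[OF assms] assms[THEN L2_cmod_square_integrable]
  by (simp add: mult.assoc)

text \<open>A bounded \<Omega> has finite measure, so constants are integrable, and
  \<open>cmod (u x)\<close> is at most \<open>1 + (cmod (u x))\<^sup>2\<close>.\<close>

lemma L2_integrable:
  assumes "open \<Omega>" "bounded \<Omega>" "u \<in> L2 \<Omega>"
  shows "integrable (lebesgue_on \<Omega>) u"
proof -
  have "\<Omega> \<in> lmeasurable" using assms by (simp add: bounded_set_imp_lmeasurable lborelD)
  then have "integrable (lebesgue_on \<Omega>) (\<lambda>x. 1 + (cmod (u x))\<^sup>2)"
    using L2_cmod_square_integrable[OF assms(3)]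
    by (intro Bochner_Integration.integrable_add finite_measure.integrable_const finite_measure_lebesgue_on)
  moreover have "norm (u x) \<le> norm (1 + (cmod (u x))\<^sup>2)" for x
  proof -
    have "2 * 1 * cmod (u x) \<le> 1\<^sup>2 + (cmod (u x))\<^sup>2" by (rule sum_squares_bound)
    then have "cmod (u x) \<le> 1 + (cmod (u x))\<^sup>2"
      using norm_ge_zero[of "u x"] unfolding power_one by linarith
    then show ?thesis by simp
  qed
  ultimately show ?thesis
    using Bochner_Integration.integrable_bound L2_measurable[OF assms(3)] by blast
qed

text \<open>In each coordinate both candidates induce the same distribution, so the fundamental
  lemma applies to their difference. The finitely many null sets are then combined.\<close>

lemma weak_gradient_unique:
  assumes \<Omega>: "open \<Omega>" "bounded \<Omega>" and g: "is_weak_gradient \<Omega> u g" and h: "is_weak_gradient \<Omega> u h"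
  shows "AE x in lebesgue_on \<Omega>. g x = h x"
proof -
  have "AE x in lebesgue_on \<Omega>. g x $ j - h x $ j = 0" for j
  proof (rule fundamental_lemma_calculus_of_variations[OF \<Omega>(1)])
    have L2: "(\<lambda>x. g x $ j) \<in> L2 \<Omega>" "(\<lambda>x. h x $ j) \<in> L2 \<Omega>"
      using g h by (auto simp: is_weak_gradient_def)
    then show "integrable (lebesgue_on \<Omega>) (\<lambda>x. g x $ j - h x $ j)"
      by (intro Bochner_Integration.integrable_diff L2_integrable[OF \<Omega>])
    fix \<phi> :: "real^'a \<Rightarrow> complex" assume \<phi>: "\<phi> \<in> test_functions \<Omega>"
    have "regular_distr \<Omega> (\<lambda>x. g x $ j) \<phi> = regular_distr \<Omega> (\<lambda>x. h x $ j) \<phi>"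
      using g h \<phi> by (simp add: is_weak_gradient_def)
    moreover have "integrable (lebesgue_on \<Omega>) (\<lambda>x. g x $ j * \<phi> x)" "integrable (lebesgue_on \<Omega>) (\<lambda>x. h x $ j * \<phi> x)"
      using L2_mult_integrable[OF _ test_functions_L2[OF \<Omega>(1) \<phi>]] L2 by blast+
    ultimately show "regular_distr \<Omega> (\<lambda>x. g x $ j - h x $ j) \<phi> = 0"
      by (simp add: regular_distr_def left_diff_distrib)
  qed
  then have "AE x in lebesgue_on \<Omega>. \<forall>j. g x $ j - h x $ j = 0"
    by (simp add: AE_all_countable)
  then show ?thesis by (rule eventually_mono) (simp add: vec_eq_iff)
qed

text \<open>This removes the choice operator: the energy may be computed from any weak gradient
  \<open>g\<close>, since the chosen one agrees with it almost everywhere. Splitting into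
  coordinates reduces the rest to scalar integrals.\<close>

lemma energy_eq:
  fixes v :: "real^'n \<Rightarrow> complex"
  assumes \<Omega>: "open \<Omega>" "bounded \<Omega>" and v: "v \<in> L2 \<Omega>" and g: "is_weak_gradient \<Omega> v g"
  shows "energy \<Omega> k f v =
    1/2 * ((\<Sum>j\<in>UNIV. LINT x|lebesgue_on \<Omega>. (cmod (g x $ j))\<^sup>2) - k\<^sup>2 * (LINT x|lebesgue_on \<Omega>. (cmod (v x))\<^sup>2))
      - Re (LINT x|lebesgue_on \<Omega>. f x * cnj (v x))"
proof -
  let ?G = "weak_gradient \<Omega> v"
  have G: "is_weak_gradient \<Omega> v ?G"
    unfolding weak_gradient_def using g by (rule someI[where P = "is_weak_gradient \<Omega> v"])
  have L2: "(\<lambda>x. ?G x $ j) \<in> L2 \<Omega>" "(\<lambda>x. g x $ j) \<in> L2 \<Omega>" for j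
    using G g by (auto simp: is_weak_gradient_def)
  have AE: "AE x in lebesgue_on \<Omega>. ?G x = g x"
    by (rule weak_gradient_unique[OF \<Omega> G g])
  have eq: "(LINT x|lebesgue_on \<Omega>. (cmod (?G x $ j))\<^sup>2) = (LINT x|lebesgue_on \<Omega>. (cmod (g x $ j))\<^sup>2)" for j
    using L2[THEN L2_cmod_square_integrable] AE
    by (intro integral_cong_AE) (auto elim!: eventually_mono)
  have norm: "(norm w)\<^sup>2 = (\<Sum>j\<in>UNIV. (cmod (w $ j))\<^sup>2)" for w :: "complex^'n"
    by (simp add: norm_vec_def L2_set_def sum_nonneg)
  have "(LINT x|lebesgue_on \<Omega>. 1/2 * ((norm (?G x))\<^sup>2 - k\<^sup>2 * (cmod (v x))\<^sup>2)) =
      1/2 * ((\<Sum>j\<in>UNIV. LINT x|lebesgue_on \<Omega>. (cmod (?G x $ j))\<^sup>2) - k\<^sup>2 * (LINT x|lebesgue_on \<Omega>. (cmod (v x))\<^sup>2))"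
    unfolding norm using L2(1)[THEN L2_cmod_square_integrable] L2_cmod_square_integrable[OF v]
    by (simp add: Bochner_Integration.integral_diff Bochner_Integration.integral_sum)
  then show ?thesis
    by (simp add: energy_def eq)
qed

lemma is_weak_gradient_add_scaleR:
  fixes u v :: "real^'n \<Rightarrow> complex"
  assumes "open \<Omega>" and u: "u \<in> L2 \<Omega>" "is_weak_gradient \<Omega> u g" and v: "v \<in> L2 \<Omega>" "is_weak_gradient \<Omega> v h"
  shows "is_weak_gradient \<Omega> (\<lambda>x. u x + t *\<^sub>R v x) (\<lambda>x. g x + t *\<^sub>R h x)"
  unfolding is_weak_gradient_def
proof (intro allI conjI ballI)
  fix j
  have L2: "(\<lambda>x. g x $ j) \<in> L2 \<Omega>" "(\<lambda>x. h x $ j) \<in> L2 \<Omega>"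
    using u v by (auto simp: is_weak_gradient_def)
  show "(\<lambda>x. (g x + t *\<^sub>R h x) $ j) \<in> L2 \<Omega>"
    using L2_add_scaleR[OF L2] by simp
  fix \<phi> :: "real^'n \<Rightarrow> complex" assume \<phi>: "\<phi> \<in> test_functions \<Omega>"
  have add: "regular_distr \<Omega> (\<lambda>x. a x + t *\<^sub>R b x) \<psi> = regular_distr \<Omega> a \<psi> + t *\<^sub>R regular_distr \<Omega> b \<psi>"
    if "a \<in> L2 \<Omega>" "b \<in> L2 \<Omega>" "\<psi> \<in> test_functions \<Omega>" for a b \<psi>
    using L2_mult_integrable[OF _ test_functions_L2[OF \<open>open \<Omega>\<close> that(3)]] that(1,2)
    by (simp add: regular_distr_def distrib_right)
  show "regular_distr \<Omega> (\<lambda>x. (g x + t *\<^sub>R h x) $ j) \<phi> = distr_partial j (regular_distr \<Omega> (\<lambda>x. u x + t *\<^sub>R v x)) \<phi>"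
    using add[OF L2 \<phi>] add[OF u(1) v(1) test_functions_partial_deriv[OF \<phi>]] u(2) v(2) \<phi>
    by (simp add: distr_partial_def is_weak_gradient_def)
qed

text \<open>Integration by parts identifies classical with weak derivatives, so test functions are
  admissible variations in \<open>H1\<close>.\<close>

lemma test_functions_weak_gradient:
  assumes "open \<Omega>" "\<phi> \<in> test_functions \<Omega>"
  shows "is_weak_gradient \<Omega> \<phi> (\<lambda>x. \<chi> j. partial_deriv j \<phi> x)"
  unfolding is_weak_gradient_def regular_distr_def distr_partial_def vec_lambda_beta
  using assms by (intro allI conjI ballI test_functions_L2 test_functions_partial_deriv
      test_functions_integration_by_parts)

text \<open>Computed with \<open>g + t h\<close>, the energy at \<open>u + t v\<close> is
  \<open>A + t * ?B + t\<^sup>2 * C\<close>, whose derivative at 0 is \<open>?B\<close>.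
  Stationarity says that this derivative is 0, and derivatives are unique.\<close>

lemma stationary_point_weak_form:
  fixes u v :: "real^'n \<Rightarrow> complex"
  assumes \<Omega>: "open \<Omega>" "bounded \<Omega>" and f: "f \<in> L2 \<Omega>" and stat: "stationary_point \<Omega> k f u"
    and g: "is_weak_gradient \<Omega> u g" and v: "v \<in> L2 \<Omega>" "is_weak_gradient \<Omega> v h"
  shows "(\<Sum>j\<in>UNIV. LINT x|lebesgue_on \<Omega>. g x $ j \<bullet> h x $ j)
      - k\<^sup>2 * (LINT x|lebesgue_on \<Omega>. u x \<bullet> v x) - Re (LINT x|lebesgue_on \<Omega>. f x * cnj (v x)) = 0"
    (is "?B = 0")
proof -
  have u: "u \<in> L2 \<Omega>" using stat by (simp add: stationary_point_def H1_def)
  have gh: "(\<lambda>x. g x $ j) \<in> L2 \<Omega>" "(\<lambda>x. h x $ j) \<in> L2 \<Omega>" for j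
    using g v by (auto simp: is_weak_gradient_def)
  define A where "A = energy \<Omega> k f u"
  define C where "C = 1/2 * ((\<Sum>j\<in>UNIV. LINT x|lebesgue_on \<Omega>. (cmod (h x $ j))\<^sup>2)
    - k\<^sup>2 * (LINT x|lebesgue_on \<Omega>. (cmod (v x))\<^sup>2))"
  have eq: "energy \<Omega> k f (\<lambda>x. u x + t *\<^sub>R v x) = A + t * ?B + t\<^sup>2 * C" for t
  proof -
    have "(LINT x|lebesgue_on \<Omega>. f x * cnj (u x + t *\<^sub>R v x)) =
        (LINT x|lebesgue_on \<Omega>. f x * cnj (u x)) + t *\<^sub>R (LINT x|lebesgue_on \<Omega>. f x * cnj (v x))"
      using L2_mult_integrable[OF f L2_cnj[OF u]] L2_mult_integrable[OF f L2_cnj[OF v(1)]]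
      by (simp add: distrib_left)
    moreover have "energy \<Omega> k f (\<lambda>x. u x + t *\<^sub>R v x) =
      1/2 * ((\<Sum>j\<in>UNIV. LINT x|lebesgue_on \<Omega>. (cmod (g x $ j + t *\<^sub>R h x $ j))\<^sup>2)
        - k\<^sup>2 * (LINT x|lebesgue_on \<Omega>. (cmod (u x + t *\<^sub>R v x))\<^sup>2))
        - Re (LINT x|lebesgue_on \<Omega>. f x * cnj (u x + t *\<^sub>R v x))"
      using energy_eq[OF \<Omega> L2_add_scaleR[OF u v(1)] is_weak_gradient_add_scaleR[OF \<Omega>(1) u g v]]
      by simp
    ultimately show ?thesis
      unfolding A_def C_def energy_eq[OF \<Omega> u g] integral_cmod_add_scaleR_square[OF gh]
        integral_cmod_add_scaleR_square[OF u v(1)]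
      by (simp add: sum.distrib sum_distrib_left[symmetric] algebra_simps)
  qed
  have "((\<lambda>t. A + t * ?B + t\<^sup>2 * C) has_real_derivative ?B) (at 0)"
    by (auto intro!: derivative_eq_intros)
  moreover have "((\<lambda>t. energy \<Omega> k f (\<lambda>x. u x + t *\<^sub>R v x)) has_real_derivative 0) (at 0)"
    using stat v by (auto simp: stationary_point_def H1_def)
  ultimately show ?thesis
    unfolding eq by (rule DERIV_unique)
qed

text \<open>The variation in direction \<open>cnj \<phi>\<close> gives the bilinear pairing with \<open>\<phi>\<close>, but only its real part.\<close>

lemma stationary_point_Re:
  fixes u \<phi> :: "real^'n \<Rightarrow> complex"
  assumes \<Omega>: "open \<Omega>" "bounded \<Omega>" and f: "f \<in> L2 \<Omega>" and stat: "stationary_point \<Omega> k f u"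
    and \<phi>: "\<phi> \<in> test_functions \<Omega>"
  shows "Re (- distr_laplacian (regular_distr \<Omega> u) \<phi> - of_real (k\<^sup>2) * regular_distr \<Omega> u \<phi>
    - regular_distr \<Omega> f \<phi>) = 0"
proof -
  let ?v = "\<lambda>x. cnj (\<phi> x)"
  obtain g where g: "is_weak_gradient \<Omega> u g" and u: "u \<in> L2 \<Omega>"
    using stat by (auto simp: stationary_point_def H1_def)
  have v: "?v \<in> test_functions \<Omega>" by (rule test_functions_cnj[OF \<phi>])
  have inner_cnj: "a \<bullet> cnj b = Re (a * b)" for a b
    by (simp add: inner_complex_def)
  have Re_k: "Re ((complex_of_real k)\<^sup>2 * z) = k\<^sup>2 * Re z" for z
    by (simp flip: of_real_power)
  \<comment> \<open>Since \<open>partial_deriv j \<phi>\<close> is itself a test function, the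
    definition of the weak gradient moves the remaining derivative from \<open>u\<close> onto it,
    with a sign change.\<close>
  have "(LINT x|lebesgue_on \<Omega>. Re (g x $ j * partial_deriv j \<phi> x))
      = - Re (regular_distr \<Omega> u (partial_deriv j (partial_deriv j \<phi>)))" for j
  proof -
    have d: "partial_deriv j \<phi> \<in> test_functions \<Omega>" by (rule test_functions_partial_deriv[OF \<phi>])
    have "(\<lambda>x. g x $ j) \<in> L2 \<Omega>" using g by (simp add: is_weak_gradient_def)
    then have "(LINT x|lebesgue_on \<Omega>. Re (g x $ j * partial_deriv j \<phi> x))
        = Re (regular_distr \<Omega> (\<lambda>x. g x $ j) (partial_deriv j \<phi>))"
      unfolding regular_distr_def by (intro integral_Re L2_mult_integrable test_functions_L2[OF \<Omega>(1) d])
    then show ?thesis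
      using g d by (simp add: is_weak_gradient_def distr_partial_def)
  qed
  moreover have "(LINT x|lebesgue_on \<Omega>. Re (u x * \<phi> x)) = Re (regular_distr \<Omega> u \<phi>)"
    unfolding regular_distr_def by (intro integral_Re L2_mult_integrable u test_functions_L2[OF \<Omega>(1) \<phi>])
  ultimately show ?thesis
    using stationary_point_weak_form[OF \<Omega> f stat g test_functions_L2[OF \<Omega>(1) v]
        test_functions_weak_gradient[OF \<Omega>(1) v]]
    by (simp add: inner_cnj Re_k test_functions_partial_deriv_cnj[OF \<phi>] distr_laplacian_def distr_partial_def
        regular_distr_def[of \<Omega> f] sum_negf del: times_complex.simps)
qed

theorem proposition3p1:
  fixes \<Omega> :: "(real^'n) set" and k :: real and f u :: "real^'n \<Rightarrow> complex"
  assumes "bounded_lipschitz_domain \<Omega>"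
    and "k > 0"
    and "f \<in> L2 \<Omega>"
    and "stationary_point \<Omega> k f u"
  shows "\<forall>\<phi>\<in>test_functions \<Omega>.
    - distr_laplacian (regular_distr \<Omega> u) \<phi> - of_real (k\<^sup>2) * regular_distr \<Omega> u \<phi>
      = regular_distr \<Omega> f \<phi>"
proof
  fix \<phi> assume \<phi>: "\<phi> \<in> test_functions \<Omega>"
  define E where "E \<psi> = - distr_laplacian (regular_distr \<Omega> u) \<psi> - of_real (k\<^sup>2) * regular_distr \<Omega> u \<psi>
    - regular_distr \<Omega> f \<psi>" for \<psi>
  have \<Omega>: "open \<Omega>" "bounded \<Omega>"
    using assms(1) by (auto simp: bounded_lipschitz_domain_def)
  have Re: "Re (E \<psi>) = 0" if "\<psi> \<in> test_functions \<Omega>" for \<psi>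
    unfolding E_def by (rule stationary_point_Re[OF \<Omega> assms(3,4) that])
  \<comment> \<open>The pairing involves no conjugation, so the factor comes out as
    \<open>\<i>\<close> itself. This makes the defect \<open>E\<close> homogeneous under
    multiplication by \<open>\<i>\<close>.\<close>
  have scale: "regular_distr \<Omega> w (\<lambda>x. \<i> * \<psi> x) = \<i> * regular_distr \<Omega> w \<psi>" for w \<psi>
    by (simp add: regular_distr_def mult.left_commute)
  have "partial_deriv j (partial_deriv j (\<lambda>x. \<i> * \<phi> x)) = (\<lambda>x. \<i> * partial_deriv j (partial_deriv j \<phi>) x)" for j
    by (simp add: test_functions_partial_deriv_cmult[OF \<phi>]
        test_functions_partial_deriv_cmult[OF test_functions_partial_deriv[OF \<phi>]])
  then have "E (\<lambda>x. \<i> * \<phi> x) = \<i> * E \<phi>"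
    by (simp add: E_def distr_laplacian_def distr_partial_def scale sum_distrib_left algebra_simps)
  \<comment> \<open>\<open>Re (\<i> * z) = - Im z\<close>, so the real part of the equation tested
    with \<open>\<i> * \<phi>\<close> controls the imaginary part tested with
    \<open>\<phi>\<close>.\<close>
  then have "Im (E \<phi>) = 0"
    using Re[OF test_functions_cmult[OF \<phi>, of \<i>]] by simp
  with Re[OF \<phi>] have "E \<phi> = 0"
    by (simp add: complex_eq_iff)
  then show "- distr_laplacian (regular_distr \<Omega> u) \<phi> - of_real (k\<^sup>2) * regular_distr \<Omega> u \<phi>
      = regular_distr \<Omega> f \<phi>"
    by (simp add: E_def)
qed

end
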